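(* There is a function $h$ such that for every real $\varepsilon>0$, every graph $G$ with average degree at least $4+\varepsilon$ contains a $K_4$-model with at most $h(\varepsilon)\cdot\log|G|$ vertices.
   Context: Graphs are finite, simple and undirected; $|G|$ is the number of vertices; the average degree is $2|E(G)|/|V(G)|$. A $K_t$-model in $G$ consists of $t$ pairwise vertex-disjoint connected subgraphs $B_1,\dots,B_t$ (branch sets) such that for all distinct $i,j$ some vertex of $B_i$ is adjacent to some vertex of $B_j$; its number of vertices is $\sum_i|B_i|$. Logarithms are binary. *)

theory Defs
  imports Complex_Main "Graph_Theory.Digraph_Component"
begin

text \<open>Finite simple undirected graphs are the symmetric digraphs of the locale \<^locale>\<open>graph\<close>:
  an undirected edge is a pair of opposite arcs, so edges are counted via their sets of ends.\<close>

definition edge_set :: "('a, 'b) pre_digraph \<Rightarrow> 'a set set" where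
  "edge_set G = (\<lambda>e. {tail G e, head G e}) ` arcs G"

text \<open>By the convention \<open>x / 0 = 0\<close> the null graph has average degree 0.\<close>

definition avg_degree :: "('a, 'b) pre_digraph \<Rightarrow> real" where
  "avg_degree G = 2 * real (card (edge_set G)) / real (card (verts G))"

text \<open>Symmetry makes each branch set a subgraph in the undirected sense; it is nonempty because
  \<^const>\<open>Digraph_Component.connected\<close> excludes the null graph.\<close>

definition clique_model ::
  "nat \<Rightarrow> ('a, 'b) pre_digraph \<Rightarrow> (nat \<Rightarrow> ('a, 'b) pre_digraph) \<Rightarrow> bool" where
  "clique_model t G B \<longleftrightarrow>
     (\<forall>i<t. subgraph (B i) G \<and> symmetric (B i) \<and> Digraph_Component.connected (B i)) \<and>
     (\<forall>i<t. \<forall>j<t. i \<noteq> j \<longrightarrow> verts (B i) \<inter> verts (B j) = {} \<and>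
        (\<exists>u \<in> verts (B i). \<exists>v \<in> verts (B j). u \<rightarrow>\<^bsub>G\<^esub> v))"

definition model_size :: "nat \<Rightarrow> (nat \<Rightarrow> ('a, 'b) pre_digraph) \<Rightarrow> nat" where
  "model_size t B = (\<Sum>i<t. card (verts (B i)))"

end

theory Submission
  imports Defs
begin

text \<open>
  Some large constant average degree forces a \<open>K\<^sub>t\<close>-model of logarithmic size, by induction on
  \<open>t\<close>: in a minimal dense subgraph, breadth-first search from any vertex meets, within
  logarithmic depth, two consecutive layers spanning many edges. A suitable subset of these layers
  still spans a dense graph while all its vertices have their parents outside of it, so the search
  tree above serves as one more branch set.

  To reach the threshold 4, take a linear-sized independent set of vertices of bounded degree and
  eliminate them one by one. A vertex of degree at most 2 is deleted, and a vertex \<open>v\<close> with a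
  neighbour \<open>u\<close> such that \<open>u\<close> and \<open>v\<close> have at most one common neighbour is contracted into
  \<open>u\<close>; both lose at most two edges per vertex. If neither applies, the neighbourhood of \<open>v\<close> has
  minimum degree at least 2, hence contains a cycle, which together with \<open>v\<close> is a \<open>K\<^sub>4\<close>-model of
  bounded size. Since \<open>|E| - 2|V|\<close> does not decrease while \<open>|V|\<close> shrinks by a constant factor,
  a number of rounds depending only on \<open>\<epsilon>\<close> yields the large constant average degree, and each
  round costs only a constant factor in the size of the model.
\<close>

section \<open>Graphs as symmetric relations\<close>

text \<open>A graph is given by the set \<open>R\<close> of its arcs, so \<open>card R\<close> is twice the number of edges and
  the average degree is \<open>card R / card V\<close>.\<close>

definition simple_graph :: "'a set \<Rightarrow> 'a rel \<Rightarrow> bool" where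
  "simple_graph V R \<longleftrightarrow> finite V \<and> R \<subseteq> V \<times> V \<and> sym R \<and> irrefl R"

text \<open>Growing a set from a root builds nonemptiness and finiteness into connectivity, and
  makes unions over a common root an induction.\<close>

inductive connected_from :: "'a rel \<Rightarrow> 'a \<Rightarrow> 'a set \<Rightarrow> bool" for R x where
  singleton: "connected_from R x {x}"
| extend: "connected_from R x B \<Longrightarrow> y \<in> B \<Longrightarrow> (y, z) \<in> R \<Longrightarrow> connected_from R x (insert z B)"

definition branch_sets :: "'a set \<Rightarrow> 'a rel \<Rightarrow> nat \<Rightarrow> (nat \<Rightarrow> 'a set) \<Rightarrow> bool" where
  "branch_sets V R t f \<longleftrightarrow>
     (\<forall>i<t. (\<exists>x. connected_from R x (f i)) \<and> f i \<subseteq> V) \<and>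
     (\<forall>i<t. \<forall>j<t. i \<noteq> j \<longrightarrow> f i \<inter> f j = {} \<and> (\<exists>x \<in> f i. \<exists>y \<in> f j. (x, y) \<in> R))"

definition has_model :: "'a set \<Rightarrow> 'a rel \<Rightarrow> nat \<Rightarrow> real \<Rightarrow> bool" where
  "has_model V R t s \<longleftrightarrow> (\<exists>f. branch_sets V R t f \<and> real (\<Sum>i<t. card (f i)) \<le> s)"

lemma simple_graph_finite_rel: "simple_graph V R \<Longrightarrow> finite R"
  unfolding simple_graph_def by (meson finite_SigmaI finite_subset)

lemma simple_graph_restrict: "simple_graph V R \<Longrightarrow> U \<subseteq> V \<Longrightarrow> simple_graph U (R \<inter> U \<times> U)"
  unfolding simple_graph_def by (auto simp: sym_def irrefl_def intro: finite_subset)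

lemma connected_from_root: "connected_from R x B \<Longrightarrow> x \<in> B"
  by (induction rule: connected_from.induct) auto

lemma connected_from_finite: "connected_from R x B \<Longrightarrow> finite B"
  by (induction rule: connected_from.induct) auto

lemma connected_from_mono: "connected_from R x B \<Longrightarrow> R \<subseteq> R' \<Longrightarrow> connected_from R' x B"
  by (induction rule: connected_from.induct) (auto intro: connected_from.intros)

lemma connected_from_Un:
  assumes "connected_from R x A" "connected_from R x B"
  shows "connected_from R x (A \<union> B)"
  using assms(2)
proof (induction rule: connected_from.induct)
  case singleton
  then show ?case using assms(1) connected_from_root by (metis Un_insert_right insert_absorb sup_bot_right)
next
  case (extend B y z)
  then show ?case by (metis UnI2 Un_insert_right connected_from.extend)
qed

lemma connected_from_UNION:
  assumes "finite I" "I \<noteq> {}" "\<And>i. i \<in> I \<Longrightarrow> connected_from R x (P i)"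
  shows "connected_from R x (\<Union>i\<in>I. P i)"
  using assms by (induction rule: finite_ne_induct) (auto intro: connected_from_Un)

lemma connected_from_attach:
  assumes "finite X" "connected_from R x B" "\<And>z. z \<in> X \<Longrightarrow> \<exists>y\<in>B. (y, z) \<in> R"
  shows "connected_from R x (B \<union> X)"
  using assms
proof (induction rule: finite_induct)
  case (insert z F)
  then show ?case using connected_from.extend[of R x "B \<union> F" _ z] by auto
qed auto

lemma branch_sets_mono:
  "branch_sets V R t f \<Longrightarrow> V \<subseteq> V' \<Longrightarrow> R \<subseteq> R' \<Longrightarrow> branch_sets V' R' t f"
  unfolding branch_sets_def by (meson connected_from_mono subset_iff)

lemma has_model_mono:
  "has_model V R t s \<Longrightarrow> V \<subseteq> V' \<Longrightarrow> R \<subseteq> R' \<Longrightarrow> s \<le> s' \<Longrightarrow> has_model V' R' t s'"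
  unfolding has_model_def by (meson branch_sets_mono order_trans)

lemma branch_sets_nonempty:
  assumes "branch_sets V R t f" "i < t"
  shows "\<exists>a. a \<in> f i \<and> a \<in> V"
proof -
  obtain x where "connected_from R x (f i)" "f i \<subseteq> V" using assms unfolding branch_sets_def by blast
  then show ?thesis using connected_from_root[of R x "f i"] by blast
qed

lemma branch_sets_apex:
  assumes f: "branch_sets W R t f" and "sym R" "W \<subseteq> V"
    and A: "connected_from R x A" "A \<subseteq> V - W"
    and att: "\<And>i. i < t \<Longrightarrow> \<exists>a\<in>f i. \<exists>b\<in>A. (a, b) \<in> R"
  shows "branch_sets V R (Suc t) (f(t := A))"
proof -
  have sub: "f i \<subseteq> W" if "i < t" for i using f that unfolding branch_sets_def by blast
  have dis: "f i \<inter> A = {}" if "i < t" for i using sub[OF that] A(2) by blast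
  have att': "\<exists>b\<in>A. \<exists>a\<in>f i. (b, a) \<in> R" if "i < t" for i
    using att[OF that] \<open>sym R\<close> by (meson symD)
  show ?thesis
    unfolding branch_sets_def
  proof (intro conjI allI impI)
    fix i assume "i < Suc t"
    then show "\<exists>x. connected_from R x ((f(t := A)) i)" "(f(t := A)) i \<subseteq> V"
      using f A \<open>W \<subseteq> V\<close> unfolding branch_sets_def by (auto simp: less_Suc_eq)
  next
    fix i j assume ij: "i < Suc t" "j < Suc t" "i \<noteq> j"
    then consider "i < t" "j < t" | "i = t" "j < t" | "i < t" "j = t" by linarith
    then have "(f(t := A)) i \<inter> (f(t := A)) j = {} \<and>
      (\<exists>x\<in>(f(t := A)) i. \<exists>y\<in>(f(t := A)) j. (x, y) \<in> R)"
    proof cases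
      case 1
      then show ?thesis using f ij unfolding branch_sets_def by auto
    next
      case 2
      then show ?thesis using dis[of j] att'[of j] by auto
    next
      case 3
      then show ?thesis using dis[of i] att[of i] by auto
    qed
    then show "(f(t := A)) i \<inter> (f(t := A)) j = {}"
      "\<exists>x\<in>(f(t := A)) i. \<exists>y\<in>(f(t := A)) j. (x, y) \<in> R" by auto
  qed
qed

text \<open>The extra branch set \<open>A\<close> is chosen after the model \<open>f\<close>, so it
  has to reach only one vertex of each branch set instead of all of \<open>W\<close>. This is what
  keeps it small.\<close>

lemma has_model_apex:
  assumes "has_model W R t s" "sym R" "W \<subseteq> V" "finite V"
    and att: "\<And>f. branch_sets W R t f \<Longrightarrow>
      \<exists>x A. connected_from R x A \<and> A \<subseteq> V - W \<and> real (card A) \<le> m \<and>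
        (\<forall>i<t. \<exists>a\<in>f i. \<exists>b\<in>A. (a, b) \<in> R)"
  shows "has_model V R (Suc t) (s + m)"
proof -
  obtain f where f: "branch_sets W R t f" "real (\<Sum>i<t. card (f i)) \<le> s"
    using assms(1) unfolding has_model_def by blast
  obtain x A where A: "connected_from R x A" "A \<subseteq> V - W" "real (card A) \<le> m"
    "\<And>i. i < t \<Longrightarrow> \<exists>a\<in>f i. \<exists>b\<in>A. (a, b) \<in> R"
    using att[OF f(1)] by blast
  have "branch_sets V R (Suc t) (f(t := A))"
    using branch_sets_apex[OF f(1) assms(2,3) A(1,2,4)] .
  moreover have "(\<Sum>i<Suc t. card ((f(t := A)) i)) = (\<Sum>i<t. card (f i)) + card A"
    by simp
  ultimately show ?thesis unfolding has_model_def using f(2) A(3)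
    by (intro exI[of _ "f(t := A)"]) auto
qed

section \<open>Large average degree\<close>

text \<open>Membership of \<open>a\<close> and \<open>b\<close> is prescribed, so such sets
  correspond to the subsets of \<open>L - {a, b}\<close>.\<close>

lemma card_subsets_fixing_two:
  assumes "finite L" "a \<in> L" "b \<in> L" "a \<noteq> b"
  shows "4 * card {X \<in> Pow L. a \<in> X \<and> (b \<in> X \<longleftrightarrow> s)} = 2 ^ card L"
proof -
  let ?g = "\<lambda>Y. if s then insert a (insert b Y) else insert a Y"
  have eq: "{X \<in> Pow L. a \<in> X \<and> (b \<in> X \<longleftrightarrow> s)} = ?g ` Pow (L - {a, b})"
  proof (intro equalityI subsetI)
    fix X assume X: "X \<in> {X \<in> Pow L. a \<in> X \<and> (b \<in> X \<longleftrightarrow> s)}"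
    then have "X = ?g (X - {a, b})" by auto
    then show "X \<in> ?g ` Pow (L - {a, b})" using X by blast
  qed (use assms in \<open>auto split: if_splits\<close>)
  have inj: "inj_on ?g (Pow (L - {a, b}))"
    by (rule inj_on_inverseI[of _ "\<lambda>X. X - {a, b}"]) auto
  have "card {X \<in> Pow L. a \<in> X \<and> (b \<in> X \<longleftrightarrow> s)} = 2 ^ card (L - {a, b})"
    unfolding eq card_image[OF inj] by (rule card_Pow) (use assms(1) in simp)
  moreover have "card L = Suc (Suc (card (L - {a, b})))"
  proof -
    have "card (L - {a, b}) = card L - 2" using assms by (simp add: card_Diff_subset)
    moreover have "card {a, b} \<le> card L" using assms by (intro card_mono) auto
    ultimately show ?thesis using assms by simp
  qed
  ultimately show ?thesis by simp
qed

text \<open>Each constraint holds for exactly a quarter of all subsets of \<open>L\<close>.\<close>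

lemma exists_subset_quarter:
  assumes "finite L" "finite Q" "\<And>q. q \<in> Q \<Longrightarrow> a q \<in> L \<and> b q \<in> L \<and> a q \<noteq> b q"
  shows "\<exists>X\<subseteq>L. card Q \<le> 4 * card {q \<in> Q. a q \<in> X \<and> (b q \<in> X \<longleftrightarrow> s q)}"
proof (rule ccontr)
  let ?c = "\<lambda>X. card {q \<in> Q. a q \<in> X \<and> (b q \<in> X \<longleftrightarrow> s q)}"
  assume "\<not> ?thesis"
  then have less: "4 * ?c X < card Q" if "X \<in> Pow L" for X using that by (meson PowD not_le)
  \<comment> \<open>Counts the pairs of a subset and a constraint satisfied by it in two ways; the
    average over all subsets is then a quarter of \<open>card Q\<close>.\<close>
  have "(\<Sum>X\<in>Pow L. ?c X) = (\<Sum>q\<in>Q. card {X \<in> Pow L. a q \<in> X \<and> (b q \<in> X \<longleftrightarrow> s q)})"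
    using sum.swap_restrict[of "Pow L" Q "\<lambda>_ _. 1::nat" "\<lambda>X q. a q \<in> X \<and> (b q \<in> X \<longleftrightarrow> s q)"] assms(1,2)
    by simp
  then have "(\<Sum>X\<in>Pow L. 4 * ?c X) = (\<Sum>q\<in>Q. 4 * card {X \<in> Pow L. a q \<in> X \<and> (b q \<in> X \<longleftrightarrow> s q)})"
    by (simp add: sum_distrib_left[symmetric])
  also have "\<dots> = (\<Sum>q\<in>Q. 2 ^ card L)"
    by (intro sum.cong refl card_subsets_fixing_two) (use assms in auto)
  also have "\<dots> = (\<Sum>X\<in>Pow L. card Q)" using assms(1) by (simp add: card_Pow)
  finally show False
    using sum_strict_mono[of "Pow L" "\<lambda>X. 4 * ?c X" "\<lambda>_. card Q"] less assms(1)
    by (simp add: Pow_not_empty)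
qed

section \<open>Breadth-first search: balls and layers\<close>

primrec ball :: "'a rel \<Rightarrow> 'a \<Rightarrow> nat \<Rightarrow> 'a set" where
  "ball R v 0 = {v}"
| "ball R v (Suc n) = ball R v n \<union> R `` ball R v n"

text \<open>These are the vertices at distance exactly \<open>n\<close> from
  \<open>v\<close>.\<close>

definition layer :: "'a rel \<Rightarrow> 'a \<Rightarrow> nat \<Rightarrow> 'a set" where
  "layer R v n = {y \<in> ball R v n. \<forall>j<n. y \<notin> ball R v j}"

lemma ball_mono: "m \<le> n \<Longrightarrow> ball R v m \<subseteq> ball R v n"
  by (rule lift_Suc_mono_le) auto

lemma ball_subset: "v \<in> V \<Longrightarrow> R \<subseteq> V \<times> V \<Longrightarrow> ball R v n \<subseteq> V"
  by (induction n) auto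

lemma layer_0 [simp]: "layer R v 0 = {v}"
  by (auto simp: layer_def)

lemma ball_layers: "ball R v n = (\<Union>i\<le>n. layer R v i)"
proof (intro equalityI subsetI)
  fix y assume y: "y \<in> ball R v n"
  define i where "i = (LEAST i. y \<in> ball R v i)"
  have "y \<in> layer R v i" "i \<le> n"
    unfolding layer_def i_def using y by (auto intro: LeastI Least_le dest: not_less_Least)
  then show "y \<in> (\<Union>i\<le>n. layer R v i)" by blast
next
  fix y assume "y \<in> (\<Union>i\<le>n. layer R v i)"
  then obtain i where "i \<le> n" "y \<in> ball R v i" unfolding layer_def by blast
  then show "y \<in> ball R v n" using ball_mono[of i n R v] by blast
qed

lemma layer_disjoint: "i \<noteq> j \<Longrightarrow> layer R v i \<inter> layer R v j = {}"
  unfolding layer_def by (auto, metis linorder_neqE_nat)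

lemma layer_parent:
  assumes "y \<in> layer R v (Suc i)"
  shows "\<exists>x\<in>layer R v i. (x, y) \<in> R"
proof -
  have y: "y \<in> ball R v (Suc i)" "\<And>j. j \<le> i \<Longrightarrow> y \<notin> ball R v j"
    using assms unfolding layer_def by auto
  then obtain x where x: "x \<in> ball R v i" "(x, y) \<in> R" by auto
  have "x \<notin> ball R v j" if "j < i" for j
    using y(2)[of "Suc j"] that x(2) by auto
  then show ?thesis using x unfolding layer_def by blast
qed

text \<open>Following parents back to the root meets each earlier layer once. The containment is
  what later keeps such paths disjoint from a set living in two deeper layers.\<close>

lemma layer_path:
  "y \<in> layer R v i \<Longrightarrow> \<exists>P. connected_from R v P \<and> y \<in> P \<and> P \<subseteq> insert y (\<Union>j<i. layer R v j) \<and> card P \<le> Suc i"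
proof (induction i arbitrary: y)
  case 0
  then show ?case by (intro exI[of _ "{v}"]) (auto intro: connected_from.intros)
next
  case (Suc i)
  obtain x where x: "x \<in> layer R v i" "(x, y) \<in> R" using layer_parent[OF Suc.prems] by blast
  obtain P where P: "connected_from R v P" "x \<in> P" "P \<subseteq> insert x (\<Union>j<i. layer R v j)" "card P \<le> Suc i"
    using Suc.IH[OF x(1)] by blast
  have "card (insert y P) \<le> Suc (Suc i)"
    using P(4) connected_from_finite[OF P(1)] by (simp add: card_insert_if)
  moreover have "P \<subseteq> (\<Union>j<Suc i. layer R v j)" using P(3) x(1) by (fastforce simp: less_Suc_eq)
  ultimately show ?case
    using connected_from.extend[OF P(1,2) x(2)] by blast
qed

text \<open>Let \<open>r\<close> be the first radius at which the ball fails to more than double.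
  Doubling at all smaller radii gives \<open>2 ^ r\<close> vertices, which bounds \<open>r\<close>
  by the logarithm of \<open>card V\<close>; for the same reason doubling cannot go on
  forever.\<close>

lemma ball_slow_growth:
  assumes "finite V" "v \<in> V" "R \<subseteq> V \<times> V"
  shows "\<exists>r. 2 ^ r \<le> card V \<and> card (ball R v (Suc r)) \<le> 2 * card (ball R v r)"
proof -
  have le: "card (ball R v r) \<le> card V" for r
    using assms ball_subset card_mono by metis
  have grow: "2 ^ k \<le> card (ball R v k)"
    if "\<And>r. r < k \<Longrightarrow> 2 * card (ball R v r) < card (ball R v (Suc r))" for k
    using that
  proof (induction k)
    case (Suc k)
    then have "2 ^ k \<le> card (ball R v k)" by simp
    then show ?case using Suc.prems[of k] by (simp del: ball.simps)
  qed simp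
  have ex: "\<exists>r. card (ball R v (Suc r)) \<le> 2 * card (ball R v r)"
  proof (rule ccontr)
    assume "\<not> ?thesis"
    then have "2 ^ card V \<le> card (ball R v (card V))" by (intro grow) (meson not_le)
    then show False using le[of "card V"] less_exp[of "card V"] by linarith
  qed
  define r where "r = (LEAST r. card (ball R v (Suc r)) \<le> 2 * card (ball R v r))"
  have "card (ball R v (Suc r)) \<le> 2 * card (ball R v r)" unfolding r_def by (rule LeastI_ex[OF ex])
  moreover have "2 ^ r \<le> card (ball R v r)"
    by (rule grow) (use not_less_Least r_def in \<open>metis not_le\<close>)
  ultimately show ?thesis using le[of r] by (meson order_trans)
qed

section \<open>From minimal dense subgraphs to models of logarithmic size\<close>

text \<open>A dense \<open>U\<close> of least cardinality works. Its use: deleting \<open>T\<close>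
  from a finite \<open>U\<close> brings the density down to at most \<open>d\<close>, so more than
  \<open>d * card T\<close> arcs within \<open>U\<close> meet \<open>T\<close>.\<close>

lemma minimal_dense_subset:
  fixes d :: real
  assumes "d * card V < card (R \<inter> V \<times> V)"
  obtains U where "U \<subseteq> V" "d * card U < card (R \<inter> U \<times> U)"
    "\<And>T. T \<subseteq> U \<Longrightarrow> finite U \<Longrightarrow> T \<noteq> {} \<Longrightarrow> card (R \<inter> (U - T) \<times> (U - T)) \<le> d * card (U - T)"
proof -
  let ?P = "\<lambda>U. U \<subseteq> V \<and> d * card U < card (R \<inter> U \<times> U)"
  obtain U where U: "?P U" "\<And>Y. ?P Y \<Longrightarrow> card U \<le> card Y"
    using ex_has_least_nat[of ?P V card] assms by blast
  have "card (R \<inter> (U - T) \<times> (U - T)) \<le> d * card (U - T)"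
    if "T \<subseteq> U" "finite U" "T \<noteq> {}" for T
  proof (rule ccontr)
    assume "\<not> ?thesis"
    then have "card U \<le> card (U - T)" using U(1) by (intro U(2)) auto
    moreover have "card (U - T) < card U" using that by (intro psubset_card_mono) auto
    ultimately show False by simp
  qed
  with U(1) show ?thesis using that by blast
qed

text \<open>Following an arc raises the distance from \<open>v\<close> by at most one; the reverse
  arc gives the bound in the other direction.\<close>

lemma layer_arc:
  assumes "sym R" "x \<in> layer R v i" "(x, y) \<in> R"
  shows "\<exists>j. y \<in> layer R v j \<and> (j = i \<or> j = Suc i \<or> i = Suc j)"
proof -
  have "y \<in> ball R v (Suc i)" using assms(2,3) unfolding layer_def by auto
  then obtain j where j: "j \<le> Suc i" "y \<in> layer R v j" unfolding ball_layers by blast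
  then have "x \<in> ball R v (Suc j)" using assms(1,3) unfolding layer_def by (auto dest: symD)
  then have "i \<le> Suc j" using assms(2) unfolding layer_def by (auto simp del: ball.simps intro: leI)
  then show ?thesis using j by (intro exI[of _ j]) auto
qed

lemma card_ball_layers:
  assumes "finite (ball R v n)"
  shows "card (ball R v n) = (\<Sum>i\<le>n. card (layer R v i))"
proof -
  have "finite (layer R v i)" if "i \<le> n" for i
    using that assms unfolding ball_layers by (meson UN_upper atMost_iff finite_subset)
  then show ?thesis unfolding ball_layers
    by (subst card_UN_disjoint) (simp_all add: layer_disjoint)
qed

text \<open>By minimality more than \<open>D\<close> times its size many arcs touch the ball of
  radius \<open>r\<close>. Up to reversal, which costs a factor 2, each of them starts in some layer
  \<open>i \<le> r\<close> and ends in layer \<open>i\<close> or \<open>Suc i\<close>. Slow growth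
  bounds the total size of these pairs of layers by 4 times the ball, so by averaging some pair has
  density above \<open>D / 8\<close>.\<close>

lemma dense_consecutive_layers:
  fixes D :: real
  assumes G: "simple_graph U E" and v: "v \<in> U" and "D \<ge> 0"
    and dense: "D * card U < card E"
    and min: "\<And>T. T \<subseteq> U \<Longrightarrow> T \<noteq> {} \<Longrightarrow> card (E \<inter> (U - T) \<times> (U - T)) \<le> D * card (U - T)"
    and slow: "card (ball E v (Suc r)) \<le> 2 * card (ball E v r)"
  obtains i where "i \<le> r" "D / 8 * (card (layer E v i) + card (layer E v (Suc i))) <
    card (E \<inter> layer E v i \<times> (layer E v i \<union> layer E v (Suc i)))"
proof -
  let ?L = "layer E v" and ?B = "ball E v r"
  let ?Q = "\<lambda>i. E \<inter> ?L i \<times> (?L i \<union> ?L (Suc i))"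
  have fin: "finite U" "finite E" and E: "E \<subseteq> U \<times> U" "sym E"
    using G simple_graph_finite_rel unfolding simple_graph_def by auto
  have BU: "ball E v n \<subseteq> U" for n using v E(1) by (rule ball_subset)
  have finB: "finite (ball E v n)" for n using BU fin(1) finite_subset by blast
  have "v \<in> ?B" using ball_mono[of 0 r E v] by simp
  then have "card (E \<inter> (U - ?B) \<times> (U - ?B)) \<le> D * card (U - ?B)"
    using BU by (intro min) auto
  moreover have "real (card (U - ?B)) = real (card U) - card ?B"
    using BU[of r] finB[of r] fin(1) by (simp add: card_Diff_subset card_mono of_nat_diff)
  moreover have "real (card E) = card (E \<inter> (U - ?B) \<times> (U - ?B)) + card (E - (U - ?B) \<times> (U - ?B))"
    using card_Int_Diff[OF fin(2)] by (metis of_nat_add)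
  ultimately have touch: "D * card ?B < card (E - (U - ?B) \<times> (U - ?B))"
    using dense by (simp add: algebra_simps)
  let ?QQ = "\<Union>i\<le>r. ?Q i"
  have out: "(x, y) \<in> ?QQ \<union> ?QQ\<inverse>" if xy: "(x, y) \<in> E" "x \<in> ?B" for x y
  proof -
    obtain i where i: "i \<le> r" "x \<in> ?L i" using \<open>x \<in> ?B\<close> unfolding ball_layers by blast
    obtain j where j: "y \<in> ?L j" "j = i \<or> j = Suc i \<or> i = Suc j"
      using layer_arc[OF E(2) i(2) xy(1)] by blast
    have "(y, x) \<in> E" using xy(1) E(2) by (meson symD)
    then show ?thesis using i j xy(1) by auto
  qed
  have "E - (U - ?B) \<times> (U - ?B) \<subseteq> ?QQ \<union> ?QQ\<inverse>"
  proof (rule subrelI)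
    fix x y assume xy: "(x, y) \<in> E - (U - ?B) \<times> (U - ?B)"
    then have "x \<in> ?B \<or> y \<in> ?B" using E(1) by blast
    moreover have "(y, x) \<in> E" using xy E(2) by (auto dest: symD)
    ultimately show "(x, y) \<in> ?QQ \<union> ?QQ\<inverse>" using out[of x y] out[of y x] xy by blast
  qed
  moreover have finQQ: "finite ?QQ" by (rule finite_subset[OF _ fin(2)]) auto
  ultimately have "card (E - (U - ?B) \<times> (U - ?B)) \<le> card (?QQ \<union> ?QQ\<inverse>)"
    by (intro card_mono) auto
  also have "\<dots> \<le> card ?QQ + card (?QQ\<inverse>)" by (rule card_Un_le)
  also have "\<dots> = 2 * card ?QQ" by simp
  also have "\<dots> \<le> 2 * (\<Sum>i\<le>r. card (?Q i))" 
    by (intro mult_le_mono2 card_UN_le) simp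
  finally have le: "D * card ?B < 2 * (\<Sum>i\<le>r. card (?Q i))" using touch
    by (smt (verit) of_nat_le_iff)
  have "\<exists>i\<le>r. D / 8 * (card (?L i) + card (?L (Suc i))) < card (?Q i)"
  proof (rule ccontr)
    assume "\<not> ?thesis"
    then have "real (\<Sum>i\<le>r. card (?Q i)) \<le> (\<Sum>i\<le>r. D / 8 * (card (?L i) + card (?L (Suc i))))"
      unfolding of_nat_sum by (intro sum_mono) (auto simp: not_less)
    also have "\<dots> = D / 8 * ((\<Sum>i\<le>r. card (?L i)) + (\<Sum>i\<le>r. card (?L (Suc i))))"
      by (subst sum_distrib_left[symmetric]) (simp add: sum.distrib)
    \<comment> \<open>The first sum is the ball itself and the second is at most the ball of radius
      \<open>Suc r\<close>, so even the factor 3 holds; 4 is a convenient rounding.\<close>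
    also have "\<dots> \<le> D / 8 * (4 * card ?B)"
    proof (rule mult_left_mono)
      have "(\<Sum>i\<le>r. card (?L i)) = card ?B" using card_ball_layers finB by metis
      moreover have "card (?L 0) + (\<Sum>i\<le>r. card (?L (Suc i))) = card (ball E v (Suc r))"
        using card_ball_layers[of E v "Suc r"] finB by (simp only: sum.atMost_Suc_shift)
      ultimately show "real ((\<Sum>i\<le>r. card (?L i)) + (\<Sum>i\<le>r. card (?L (Suc i)))) \<le> 4 * card ?B"
        using slow by linarith
    qed (use \<open>D \<ge> 0\<close> in simp)
    finally show False using le by simp
  qed
  then show ?thesis using that by blast
qed

text \<open>Each vertex of layer \<open>Suc i\<close> gets a parent in layer \<open>i\<close>. For a
  random subset \<open>X\<close> of layer \<open>i\<close>, the set \<open>W\<close> consists of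
  \<open>X\<close> and of those vertices of layer \<open>Suc i\<close> whose parent is not in
  \<open>X\<close>. Then every vertex of \<open>W\<close> has a parent outside \<open>W\<close> from
  which the search tree leads back to \<open>v\<close> avoiding \<open>W\<close>, and an arc that is
  not a chosen parent arc survives in \<open>W\<close> with probability a quarter.\<close>

lemma dense_subset_with_apex_tree:
  fixes d :: real
  assumes G: "simple_graph V R" and "d \<ge> 0" and dense: "(32 * d + 8) * card V < card R"
  shows "\<exists>W v r. W \<subseteq> V \<and> d * card W < card (R \<inter> W \<times> W) \<and> 2 ^ r \<le> card V \<and>
    (\<forall>w\<in>W. \<exists>P. connected_from R v P \<and> P \<subseteq> V - W \<and> card P \<le> Suc r \<and> (\<exists>p\<in>P. (w, p) \<in> R))"
proof -
  define D where "D = 32 * d + 8"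
  have V: "finite V" "R \<inter> V \<times> V = R" using G unfolding simple_graph_def by auto
  obtain U where U: "U \<subseteq> V" "D * card U < card (R \<inter> U \<times> U)"
    and min: "\<And>T. T \<subseteq> U \<Longrightarrow> finite U \<Longrightarrow> T \<noteq> {} \<Longrightarrow> card (R \<inter> (U - T) \<times> (U - T)) \<le> D * card (U - T)"
    using minimal_dense_subset[of D V R] dense V(2) unfolding D_def by metis
  define E where "E = R \<inter> U \<times> U"
  have GE: "simple_graph U E" unfolding E_def using G U(1) by (rule simple_graph_restrict)
  have fin: "finite U" "finite E" and E: "E \<subseteq> U \<times> U" "sym E" "irrefl E" "E \<subseteq> R"
    using GE simple_graph_finite_rel unfolding simple_graph_def E_def by auto
  have "U \<noteq> {}" using U(2) by auto
  then obtain v where v: "v \<in> U" by blast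
  obtain r where r: "2 ^ r \<le> card U" "card (ball E v (Suc r)) \<le> 2 * card (ball E v r)"
    using ball_slow_growth[OF fin(1) v E(1)] by blast
  let ?L = "layer E v"
  have minE: "card (E \<inter> (U - T) \<times> (U - T)) \<le> D * card (U - T)" if "T \<subseteq> U" "T \<noteq> {}" for T
  proof -
    have "E \<inter> (U - T) \<times> (U - T) = R \<inter> (U - T) \<times> (U - T)" unfolding E_def by auto
    then show ?thesis using min[OF that(1) fin(1) that(2)] by simp
  qed
  have "D \<ge> 0" unfolding D_def using \<open>d \<ge> 0\<close> by simp
  obtain i where i: "i \<le> r" "D / 8 * (card (?L i) + card (?L (Suc i))) <
      card (E \<inter> ?L i \<times> (?L i \<union> ?L (Suc i)))"
    using dense_consecutive_layers[OF GE v \<open>D \<ge> 0\<close> U(2)[folded E_def] minE r(2)] by blast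
  have LU: "?L j \<subseteq> U" for j using ball_subset[OF v E(1), of j] unfolding layer_def by auto
  have finL: "finite (?L j)" for j using LU fin(1) finite_subset by blast
  obtain p where p: "\<And>y. y \<in> ?L (Suc i) \<Longrightarrow> p y \<in> ?L i \<and> (p y, y) \<in> E"
    using layer_parent by metis
  \<comment> \<open>Arcs from a chosen parent to its child can never survive: tail and head would
    make opposite demands on the same vertex.\<close>
  define Q where "Q = E \<inter> ?L i \<times> (?L i \<union> ?L (Suc i)) - (\<lambda>y. (p y, y)) ` ?L (Suc i)"
  have finQ: "finite Q" unfolding Q_def using fin(2) by simp
  have "card (E \<inter> ?L i \<times> (?L i \<union> ?L (Suc i))) - card ((\<lambda>y. (p y, y)) ` ?L (Suc i)) \<le> card Q"
    unfolding Q_def using finL by (intro diff_card_le_card_Diff) simp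
  moreover have "card ((\<lambda>y. (p y, y)) ` ?L (Suc i)) \<le> card (?L (Suc i))" using finL card_image_le by blast
  \<comment> \<open>Here \<open>D / 8 = 4 * d + 1\<close>: the 1 pays for the discarded parent arcs,
    one per vertex of layer \<open>Suc i\<close>, and the 4 for passing to a random subset.\<close>
  ultimately have cQ: "4 * (d * (card (?L i) + card (?L (Suc i)))) < card Q"
    using i(2) unfolding D_def by (simp add: algebra_simps)
  have disj: "?L i \<inter> ?L (Suc i) = {}" by (rule layer_disjoint) simp
  \<comment> \<open>The vertex of layer \<open>i\<close> that decides whether the head of
    \<open>q\<close> enters \<open>W\<close>: the head itself, which must lie in \<open>X\<close>,
    or else its parent, which must not.\<close>
  let ?b = "\<lambda>q. if snd q \<in> ?L i then snd q else p (snd q)"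
  have Qp: "fst q \<in> ?L i \<and> ?b q \<in> ?L i \<and> fst q \<noteq> ?b q" if "q \<in> Q" for q
    using that p E(3) unfolding Q_def irrefl_def by (cases q) auto
  obtain X where X: "X \<subseteq> ?L i"
    "card Q \<le> 4 * card {q \<in> Q. fst q \<in> X \<and> (?b q \<in> X \<longleftrightarrow> snd q \<in> ?L i)}"
    using exists_subset_quarter[OF finL finQ Qp, where s = "\<lambda>q. snd q \<in> ?L i"] that by meson
  define W where "W = X \<union> {y \<in> ?L (Suc i). p y \<notin> X}"
  have WL: "W \<subseteq> ?L i \<union> ?L (Suc i)" unfolding W_def using X(1) by auto
  have "{q \<in> Q. fst q \<in> X \<and> (?b q \<in> X \<longleftrightarrow> snd q \<in> ?L i)} \<subseteq> R \<inter> W \<times> W"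
    unfolding W_def Q_def using E(4) by (auto split: if_splits)
  then have "card {q \<in> Q. fst q \<in> X \<and> (?b q \<in> X \<longleftrightarrow> snd q \<in> ?L i)} \<le> card (R \<inter> W \<times> W)"
    by (rule card_mono[rotated]) (use simple_graph_finite_rel[OF G] in simp)
  then have "d * (card (?L i) + card (?L (Suc i))) < card (R \<inter> W \<times> W)"
    using cQ X(2) by linarith
  moreover have "card W \<le> card (?L i) + card (?L (Suc i))"
    using card_mono[OF _ WL] finL card_Un_le[of "?L i" "?L (Suc i)"] by fastforce
  ultimately have dW: "d * card W < card (R \<inter> W \<times> W)"
    using \<open>d \<ge> 0\<close> by (smt (verit) mult_left_mono of_nat_le_iff)
  have "0 \<le> 4 * (d * (card (?L i) + card (?L (Suc i))))" using \<open>d \<ge> 0\<close> by simp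
  then have "card Q \<noteq> 0" using cQ by linarith
  then obtain q where q: "q \<in> Q" by (metis card.empty ex_in_conv)
  \<comment> \<open>Layer 0 is a single vertex, but an arc in \<open>Q\<close> yields two distinct
    vertices of layer \<open>i\<close>. Hence the vertices of \<open>X\<close> have parents as
    well.\<close>
  obtain i' where i': "i = Suc i'"
  proof (cases i)
    case 0
    then show ?thesis using Qp[OF q] by (metis layer_0 singletonD)
  qed
  \<comment> \<open>The tree path to \<open>x\<close> uses, besides \<open>x\<close>, only layers
    below \<open>i\<close>, whereas \<open>W\<close> lies in layers \<open>i\<close> and
    \<open>Suc i\<close>.\<close>
  have path: "\<exists>P. connected_from R v P \<and> P \<subseteq> V - W \<and> card P \<le> Suc r \<and> (\<exists>p\<in>P. (w, p) \<in> R)"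
    if x: "x \<in> ?L j" "(x, w) \<in> E" "j \<le> i" "x \<notin> W" for w x j
  proof -
    obtain P where P: "connected_from E v P" "x \<in> P" "P \<subseteq> insert x (\<Union>k<j. ?L k)" "card P \<le> Suc j"
      using layer_path[OF x(1)] by blast
    have "?L k \<inter> W = {}" if "k < j" for k
      using WL layer_disjoint[of k i E v] layer_disjoint[of k "Suc i" E v] that x(3) by fastforce
    then have "P \<subseteq> V - W" using P(3) x(1,4) LU U(1) by blast
    moreover have "(w, x) \<in> R" using x(2) E(2,4) by (meson symD subsetD)
    ultimately show ?thesis using P x(3) i(1) connected_from_mono[OF P(1) E(4)] by (metis Suc_le_mono order_trans)
  qed
  have "\<exists>P. connected_from R v P \<and> P \<subseteq> V - W \<and> card P \<le> Suc r \<and> (\<exists>p\<in>P. (w, p) \<in> R)"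
    if "w \<in> W" for w
  proof (cases "w \<in> X")
    case True
    then obtain x where x: "x \<in> ?L i'" "(x, w) \<in> E" 
      using layer_parent[of w E v i'] X(1) i' by blast
    then have "x \<notin> W" using WL layer_disjoint[of i' i E v] layer_disjoint[of i' "Suc i" E v] i' by fastforce
    then show ?thesis using path[OF x] i' by simp
  next
    case False
    then have w: "w \<in> ?L (Suc i)" "p w \<notin> X" using that unfolding W_def by auto
    then have "p w \<notin> W" using p disj unfolding W_def by blast
    then show ?thesis using path[of "p w" i w] p[OF w(1)] by simp
  qed
  moreover have "2 ^ r \<le> card V" using r(1) card_mono[OF V(1) U(1)] by linarith
  moreover have "W \<subseteq> V" using WL LU U(1) by blast
  ultimately show ?thesis using dW by blast
qed

text \<open>Induction on \<open>t\<close>: the model found inside \<open>W\<close> is extended by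
  the union of tree paths from the root \<open>v\<close> to one vertex of each branch set. The
  summand 1 keeps the bound positive for a single vertex and covers a path of depth \<open>r\<close>
  having \<open>Suc r\<close> vertices.\<close>

theorem dense_has_logarithmic_model:
  shows "\<exists>d C. d \<ge> (0::real) \<and> C \<ge> (0::real) \<and> (\<forall>(V :: 'a set) R. simple_graph V R \<and> d * card V < card R \<longrightarrow>
    has_model V R t (C * (1 + log 2 (card V))))"
proof (induction t)
  case 0
  show ?case by (intro exI[of _ 0]) (auto simp: has_model_def branch_sets_def)
next
  case (Suc t)
  then obtain d C :: real where dC: "d \<ge> 0" "C \<ge> 0"
    and IH: "\<forall>(V :: 'a set) R. simple_graph V R \<and> d * card V < card R \<longrightarrow>
      has_model V R t (C * (1 + log 2 (card V)))"
    by blast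
  have "has_model V R (Suc t) ((C + (t + 1)) * (1 + log 2 (card V)))"
    if G: "simple_graph V R" and dense: "(32 * d + 8) * card V < card R" for V :: "'a set" and R
  proof -
    obtain W v r where W: "W \<subseteq> V" "d * card W < card (R \<inter> W \<times> W)" and r: "2 ^ r \<le> card V"
      and path: "\<And>w. w \<in> W \<Longrightarrow> \<exists>P. connected_from R v P \<and> P \<subseteq> V - W \<and> card P \<le> Suc r \<and> (\<exists>p\<in>P. (w, p) \<in> R)"
      using dense_subset_with_apex_tree[OF G dC(1) dense] by blast
    have fin: "finite V" "sym R" using G unfolding simple_graph_def by auto
    have "W \<noteq> {}" using W(2) by auto
    then obtain w0 where w0: "w0 \<in> W" by blast
    have Wpos: "card W > 0" "card W \<le> card V" using w0 W(1) fin(1) finite_subset card_gt_0_iff card_mono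
      by (metis empty_iff, metis)
    let ?n = "1 + log 2 (card V)"
    have "has_model W R t (C * (1 + log 2 (card W)))"
      by (rule has_model_mono[OF IH[rule_format, of W "R \<inter> W \<times> W"]])
        (use simple_graph_restrict[OF G W(1)] W(2) in auto)
    moreover have "C * (1 + log 2 (card W)) \<le> C * ?n"
      using Wpos dC(2) by (intro mult_left_mono) auto
    ultimately have model: "has_model W R t (C * ?n)" using has_model_mono by blast
    have rn: "real (Suc r) \<le> ?n"
    proof -
      have "real r = log 2 (2 ^ r)" by simp
      also have "\<dots> \<le> log 2 (card V)"
        using r Wpos by (subst log_le_cancel_iff) (auto simp flip: of_nat_le_iff)
      finally show ?thesis by simp
    qed
    have "has_model V R (Suc t) (C * ?n + (t + 1) * ?n)"
    proof (rule has_model_apex[OF model fin(2) W(1) fin(1)])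
      fix f assume f: "branch_sets W R t f"
      obtain a where a: "\<And>i. i < t \<Longrightarrow> a i \<in> f i \<and> a i \<in> W"
        using branch_sets_nonempty[OF f] by metis
      \<comment> \<open>Index \<open>t\<close> is served by \<open>w0\<close>, so the union
        \<open>A\<close> of the paths is nonempty even for \<open>t = 0\<close>.\<close>
      define w where "w i = (if i < t then a i else w0)" for i
      have w: "w i \<in> W" for i using a w0 unfolding w_def by auto
      obtain P where P: "\<And>i. connected_from R v (P i) \<and> P i \<subseteq> V - W \<and> card (P i) \<le> Suc r \<and> (\<exists>p\<in>P i. (w i, p) \<in> R)"
        using path[OF w] by metis
      define A where "A = (\<Union>i\<le>t. P i)"
      have "connected_from R v A" unfolding A_def using P by (intro connected_from_UNION) auto
      moreover have "A \<subseteq> V - W" unfolding A_def using P by blast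
      moreover have "real (card A) \<le> (t + 1) * ?n"
      proof -
        have "card A \<le> (\<Sum>i\<le>t. card (P i))" unfolding A_def by (rule card_UN_le) simp
        also have "\<dots> \<le> (\<Sum>i\<le>t. Suc r)" using P by (intro sum_mono) auto
        also have "\<dots> = (t + 1) * Suc r" by simp
        finally have "real (card A) \<le> real (t + 1) * Suc r" by (metis of_nat_le_iff of_nat_mult)
        also have "\<dots> \<le> (t + 1) * ?n" using rn by (intro mult_left_mono) auto
        finally show ?thesis .
      qed
      moreover have "\<forall>i<t. \<exists>a\<in>f i. \<exists>b\<in>A. (a, b) \<in> R"
      proof (intro allI impI)
        fix i assume i: "i < t"
        then have "w i \<in> f i" using a unfolding w_def by simp
        moreover have "P i \<subseteq> A" unfolding A_def by (rule UN_upper) (use i in simp)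
        ultimately show "\<exists>a\<in>f i. \<exists>b\<in>A. (a, b) \<in> R" using P[of i] by blast
      qed
      ultimately show "\<exists>x A. connected_from R x A \<and> A \<subseteq> V - W \<and> real (card A) \<le> (t + 1) * ?n \<and>
        (\<forall>i<t. \<exists>a\<in>f i. \<exists>b\<in>A. (a, b) \<in> R)" by blast
    qed
    then show ?thesis by (simp add: algebra_simps)
  qed
  then show ?case using dC by (intro exI[of _ "32 * d + 8"] exI[of _ "C + (t + 1)"]) auto
qed

section \<open>Eliminating vertices of bounded degree\<close>

text \<open>Each growth step costs the new vertex and at most one eliminated vertex subdividing its
  arc, hence the factor 2. The eliminated vertices added to \<open>B\<close> have their
  \<open>u v\<close> in \<open>B\<close>, so sets disjoint from each other and from \<open>S\<close>
  stay disjoint after lifting.\<close>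

lemma lift_connected_from:
  assumes "connected_from R' x B" "sym R"
    and arc: "\<And>x y. (x, y) \<in> R' \<Longrightarrow> (x, y) \<notin> R \<Longrightarrow>
      \<exists>v\<in>S. (u v = x \<or> u v = y) \<and> (v, x) \<in> R \<and> (v, y) \<in> R"
  shows "\<exists>B'. connected_from R x B' \<and> B \<subseteq> B' \<and> B' \<subseteq> B \<union> {v \<in> S. u v \<in> B} \<and>
    card B' \<le> 2 * card B"
  using assms(1)
proof (induction rule: connected_from.induct)
  case singleton
  show ?case by (intro exI[of _ "{x}"]) (auto intro: connected_from.intros)
next
  case (extend B y z)
  then obtain B' where B': "connected_from R x B'" "B \<subseteq> B'" "B' \<subseteq> B \<union> {v \<in> S. u v \<in> B}"
    "card B' \<le> 2 * card B" by blast
  have fin: "finite B" "finite B'"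
    using connected_from_finite[OF extend.hyps(1)] connected_from_finite[OF B'(1)] by auto
  show ?case
  proof (cases "z \<in> B")
    case True
    then show ?thesis using B' by (simp add: insert_absorb) blast
  next
    case z: False
    then have cz: "card (insert z B) = Suc (card B)" using fin by simp
    show ?thesis
    proof (cases "(y, z) \<in> R")
      case True
      have "connected_from R x (insert z B')"
        using connected_from.extend[OF B'(1) _ True] B'(2) extend.hyps(2) by blast
      moreover have "card (insert z B') \<le> 2 * card (insert z B)"
        using B'(4) cz fin by (simp add: card_insert_if)
      moreover have "insert z B' \<subseteq> insert z B \<union> {v \<in> S. u v \<in> insert z B}" using B'(3) by blast
      ultimately show ?thesis using B'(2) by (intro exI[of _ "insert z B'"]) blast
    next
      case False
      then obtain v where v: "v \<in> S" "u v = y \<or> u v = z" "(v, y) \<in> R" "(v, z) \<in> R"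
        using arc extend.hyps(3) by blast
      then have "(y, v) \<in> R" using \<open>sym R\<close> by (meson symD)
      then have "connected_from R x (insert v B')"
        using connected_from.extend[OF B'(1)] B'(2) extend.hyps(2) by blast
      then have "connected_from R x (insert z (insert v B'))"
        using connected_from.extend[of R x "insert v B'" v z] v(4) by simp
      moreover have "card (insert z (insert v B')) \<le> 2 * card (insert z B)"
        using B'(4) cz fin by (simp add: card_insert_if)
      moreover have "insert z (insert v B') \<subseteq> insert z B \<union> {v \<in> S. u v \<in> insert z B}"
        using B'(3) v(1,2) extend.hyps(2) by blast
      ultimately show ?thesis using B'(2) by (intro exI[of _ "insert z (insert v B')"]) blast
    qed
  qed
qed

text \<open>A new arc is replaced by a path of length two through the eliminated vertex \<open>v\<close>, which
  joins the branch set containing \<open>u v\<close>. Only the arcs that the model uses are replaced, so the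
  bound does not depend on how many vertices share the same \<open>u v\<close>.\<close>

lemma lift_has_model:
  assumes model: "has_model (V - S) R' t s" and "sym R" "S \<subseteq> V"
    and arc: "\<And>x y. (x, y) \<in> R' \<Longrightarrow> (x, y) \<notin> R \<Longrightarrow>
      \<exists>v\<in>S. (u v = x \<or> u v = y) \<and> (v, x) \<in> R \<and> (v, y) \<in> R"
  shows "has_model V R t (real (2 * t + 2) * s)"
proof -
  obtain f where f: "branch_sets (V - S) R' t f" and size: "real (\<Sum>i<t. card (f i)) \<le> s"
    using model unfolding has_model_def by blast
  have con: "\<exists>x. connected_from R' x (f i)" and sub: "f i \<subseteq> V - S" if "i < t" for i
    using f that unfolding branch_sets_def by auto
  have dis: "f i \<inter> f j = {}" and adj: "\<exists>x\<in>f i. \<exists>y\<in>f j. (x, y) \<in> R'"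
    if "i < t" "j < t" "i \<noteq> j" for i j
    using f that unfolding branch_sets_def by auto
  obtain x where x: "\<And>i. i < t \<Longrightarrow> connected_from R' (x i) (f i)" using con by metis
  have "\<exists>B'. connected_from R (x i) B' \<and> f i \<subseteq> B' \<and> B' \<subseteq> f i \<union> {v \<in> S. u v \<in> f i} \<and>
      card B' \<le> 2 * card (f i)" if "i < t" for i
    using lift_connected_from[OF x[OF that] \<open>sym R\<close> arc] .
  then obtain g where g: "\<And>i. i < t \<Longrightarrow> connected_from R (x i) (g i) \<and> f i \<subseteq> g i \<and>
      g i \<subseteq> f i \<union> {v \<in> S. u v \<in> f i} \<and> card (g i) \<le> 2 * card (f i)"
    by metis
  obtain a b where ab: "\<And>i j. i < t \<Longrightarrow> j < t \<Longrightarrow> i \<noteq> j \<Longrightarrow>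
      a i j \<in> f i \<and> b i j \<in> f j \<and> (a i j, b i j) \<in> R'"
    using adj by metis
  define need where "need i j \<longleftrightarrow> i < t \<and> j < t \<and> i \<noteq> j \<and> (a i j, b i j) \<notin> R" for i j
  have "\<exists>w. need i j \<longrightarrow> w \<in> S \<and> (u w = a i j \<or> u w = b i j) \<and> (w, a i j) \<in> R \<and> (w, b i j) \<in> R"
    for i j
    using arc[of "a i j" "b i j"] ab[of i j] unfolding need_def by blast
  then obtain w where w: "\<And>i j. need i j \<Longrightarrow> w i j \<in> S \<and>
      (u (w i j) = a i j \<or> u (w i j) = b i j) \<and> (w i j, a i j) \<in> R \<and> (w i j, b i j) \<in> R"
    by metis
  \<comment> \<open>The linking vertices handed to branch set \<open>k\<close>: those subdividing an
    arc between \<open>k\<close> and another branch set whose end in \<open>k\<close> is the value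
    of \<open>u\<close>.\<close>
  define X where "X k = {w k j | j. need k j \<and> u (w k j) = a k j} \<union>
    {w j k | j. need j k \<and> u (w j k) = b j k}" for k
  have Xsub: "X k \<subseteq> w k ` {..<t} \<union> (\<lambda>j. w j k) ` {..<t}" for k
    unfolding X_def need_def by auto
  have finX: "finite (X k)" for k using Xsub by (rule finite_subset) simp
  have cX: "card (X k) \<le> 2 * t" for k
  proof -
    have "card (X k) \<le> card (w k ` {..<t} \<union> (\<lambda>j. w j k) ` {..<t})"
      using Xsub by (intro card_mono) auto
    also have "\<dots> \<le> card (w k ` {..<t}) + card ((\<lambda>j. w j k) ` {..<t})" by (rule card_Un_le)
    also have "\<dots> \<le> card {..<t} + card {..<t}" by (intro add_mono card_image_le) auto
    finally show ?thesis by simp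
  qed
  have X: "v \<in> S \<and> u v \<in> f k \<and> (\<exists>y\<in>f k. (y, v) \<in> R)" if vX: "v \<in> X k" for v k
  proof -
    consider j where "v = w k j" "need k j" "u (w k j) = a k j"
      | j where "v = w j k" "need j k" "u (w j k) = b j k"
      using vX unfolding X_def by blast
    then show ?thesis
    proof cases
      case 1
      then show ?thesis using w[of k j] ab[of k j] \<open>sym R\<close> unfolding need_def by (metis symD)
    next
      case 2
      then show ?thesis using w[of j k] ab[of j k] \<open>sym R\<close> unfolding need_def by (metis symD)
    qed
  qed
  define h where "h i = g i \<union> X i" for i
  have hsub: "h i \<subseteq> f i \<union> {v \<in> S. u v \<in> f i}" if "i < t" for i
    using g[OF that] X unfolding h_def by blast
  have hsup: "f i \<subseteq> h i" if "i < t" for i using g[OF that] unfolding h_def by blast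
  have "branch_sets V R t h"
    unfolding branch_sets_def
  proof (intro conjI allI impI)
    fix i assume i: "i < t"
    have "connected_from R (x i) (h i)"
      unfolding h_def
    proof (rule connected_from_attach[OF finX])
      show "connected_from R (x i) (g i)" using g[OF i] by blast
      show "\<exists>y\<in>g i. (y, z) \<in> R" if "z \<in> X i" for z using X[OF that] g[OF i] by blast
    qed
    then show "\<exists>x. connected_from R x (h i)" ..
    show "h i \<subseteq> V" using hsub[OF i] sub[OF i] \<open>S \<subseteq> V\<close> by blast
  next
    fix i j assume ij: "i < t" "j < t" "i \<noteq> j"
    show "h i \<inter> h j = {}"
      using hsub[OF ij(1)] hsub[OF ij(2)] sub[OF ij(1)] sub[OF ij(2)] dis[OF ij] by blast
    show "\<exists>x\<in>h i. \<exists>y\<in>h j. (x, y) \<in> R"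
    proof (cases "need i j")
      case False
      then show ?thesis using ij ab[OF ij] hsup unfolding need_def by blast
    next
      case True
      have ab': "a i j \<in> h i" "b i j \<in> h j" using ab[OF ij] hsup ij by auto
      consider "u (w i j) = a i j" | "u (w i j) = b i j" using w[OF True] by blast
      then show ?thesis
      proof cases
        case 1
        then have "w i j \<in> h i" using True unfolding h_def X_def by blast
        then show ?thesis using w[OF True] ab'(2) by blast
      next
        case 2
        then have "w i j \<in> h j" using True unfolding h_def X_def by blast
        moreover have "(a i j, w i j) \<in> R" using w[OF True] \<open>sym R\<close> by (meson symD)
        ultimately show ?thesis using ab'(1) by blast
      qed
    qed
  qed
  moreover have "real (\<Sum>i<t. card (h i)) \<le> real (2 * t + 2) * s"
  proof -
    \<comment> \<open>Lifting gives the factor 2, and at most \<open>2 * t\<close> linking vertices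
      are added; as \<open>f i\<close> is nonempty, this additive term becomes a factor.\<close>
    have "card (h i) \<le> (2 * t + 2) * card (f i)" if "i < t" for i
    proof -
      have "card (f i) \<ge> 1"
        using con[OF that] connected_from_root connected_from_finite
        by (metis One_nat_def Suc_leI card_gt_0_iff empty_iff)
      then have "2 * t * 1 \<le> 2 * t * card (f i)" by (intro mult_le_mono2)
      moreover have "card (h i) \<le> card (g i) + card (X i)" unfolding h_def by (rule card_Un_le)
      moreover have "card (g i) \<le> 2 * card (f i)" using g[OF that] by blast
      ultimately show ?thesis using cX[of i] by (simp add: algebra_simps)
    qed
    then have "(\<Sum>i<t. card (h i)) \<le> (2 * t + 2) * (\<Sum>i<t. card (f i))"
      unfolding sum_distrib_left by (intro sum_mono) auto
    then have "real (\<Sum>i<t. card (h i)) \<le> real (2 * t + 2) * real (\<Sum>i<t. card (f i))"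
      by (metis of_nat_le_iff of_nat_mult)
    also have "\<dots> \<le> real (2 * t + 2) * s" using size by (intro mult_left_mono) auto
    finally show ?thesis .
  qed
  ultimately show ?thesis unfolding has_model_def by (intro exI[of _ h] conjI)
qed

section \<open>Eliminating a single vertex\<close>

lemma branch_sets_size:
  assumes "branch_sets V R t f" "finite V"
  shows "(\<Sum>i<t. card (f i)) \<le> card V"
proof -
  have sub: "\<forall>i<t. f i \<subseteq> V" and dis: "\<forall>i<t. \<forall>j<t. i \<noteq> j \<longrightarrow> f i \<inter> f j = {}"
    using assms(1) unfolding branch_sets_def by auto
  have "finite (f i)" if "i < t" for i using sub assms(2) that finite_subset by metis
  then have "(\<Sum>i<t. card (f i)) = card (\<Union>i<t. f i)"
    using dis by (subst card_UN_disjoint) simp_all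
  also have "\<dots> \<le> card V" using sub assms(2) by (intro card_mono) auto
  finally show ?thesis .
qed

text \<open>The last vertex of a longest path has two neighbours on the path.\<close>

lemma min_degree_two_triangle_model:
  assumes G: "simple_graph N E" and "N \<noteq> {}" and deg: "\<And>x. x \<in> N \<Longrightarrow> 2 \<le> card (E `` {x})"
  shows "has_model N E 3 (card N)"
proof -
  have fin: "finite N" and E: "E \<subseteq> N \<times> N" "sym E" "irrefl E"
    using G unfolding simple_graph_def by auto
  define path where "path p k \<longleftrightarrow> inj_on p {..k} \<and> p ` {..k} \<subseteq> N \<and> (\<forall>i<k. (p i, p (Suc i)) \<in> E)"
    for p :: "nat \<Rightarrow> 'a" and k
  have bound: "k < card N" if "path p k" for p k
  proof -
    have "card (p ` {..k}) = Suc k" using that unfolding path_def by (simp add: card_image)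
    then show ?thesis using that fin card_mono[of N "p ` {..k}"] unfolding path_def by simp
  qed
  obtain x0 where "x0 \<in> N" using \<open>N \<noteq> {}\<close> by blast
  then have ex: "\<exists>p. path p 0" unfolding path_def by (intro exI[of _ "\<lambda>_. x0"]) auto
  obtain k where k: "\<exists>p. path p k" "\<And>k'. \<exists>p. path p k' \<Longrightarrow> k' \<le> k"
    using ex_has_greatest_nat[of "\<lambda>k. \<exists>p. path p k" 0 "\<lambda>k. k" "card N"] ex bound
    by (metis nat_less_le)
  obtain p where p: "inj_on p {..k}" "p ` {..k} \<subseteq> N" "\<And>i. i < k \<Longrightarrow> (p i, p (Suc i)) \<in> E"
    using k(1) unfolding path_def by blast
  \<comment> \<open>A neighbour off the path would extend it, against the choice of
    \<open>k\<close>.\<close>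
  have nb: "y \<in> p ` {..k}" if "(p k, y) \<in> E" for y
  proof (rule ccontr)
    assume y: "y \<notin> p ` {..k}"
    have "path (p(Suc k := y)) (Suc k)"
      unfolding path_def
    proof (intro conjI allI impI)
      have "inj_on (p(Suc k := y)) {..k}" using p(1) by (auto simp: inj_on_def)
      then show "inj_on (p(Suc k := y)) {..Suc k}" using y by (auto simp: atMost_Suc)
      show "(p(Suc k := y)) ` {..Suc k} \<subseteq> N" using p(2) that E(1) by (auto simp: atMost_Suc)
      fix i assume "i < Suc k"
      then show "((p(Suc k := y)) i, (p(Suc k := y)) (Suc i)) \<in> E"
        using p(3) that by (auto simp: less_Suc_eq)
    qed
    then show False using k(2)[of "Suc k"] by auto
  qed
  have "p k \<in> N" using p(2) by auto
  then obtain y1 y2 where y: "(p k, y1) \<in> E" "(p k, y2) \<in> E" "y1 \<noteq> y2"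
    using deg[of "p k"] by (auto simp: card_le_Suc_iff numeral_2_eq_2)
  then obtain i j where ij: "i < j" "j \<le> k" "(p k, p i) \<in> E" "(p k, p j) \<in> E"
    using nb[OF y(1)] nb[OF y(2)] by (metis atMost_iff imageE linorder_neqE_nat)
  then have "j < k" using E(3) by (metis irrefl_def le_neq_implies_less)
  have con: "connected_from E (p (Suc i)) (p ` {Suc i..m})" if "Suc i \<le> m" "m \<le> k" for m
    using that
  proof (induction m rule: dec_induct)
    case base
    show ?case by (simp add: connected_from.singleton)
  next
    case (step m)
    then have "p ` {Suc i..Suc m} = insert (p (Suc m)) (p ` {Suc i..m})"
      by (simp add: atLeastAtMostSuc_conv)
    moreover have "(p m, p (Suc m)) \<in> E" "p m \<in> p ` {Suc i..m}" using p(3) step by auto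
    ultimately show ?case using step connected_from.extend by (metis Suc_leD)
  qed
  \<comment> \<open>The cycle closed by the arc from \<open>p k\<close> to \<open>p i\<close> is cut
    into these two vertices and the segment between them, which is nonempty because it contains
    \<open>p j\<close>.\<close>
  define C where "C = p ` {Suc i..k - 1}"
  have C: "connected_from E (p (Suc i)) C" unfolding C_def using ij \<open>j < k\<close> by (intro con) auto
  have CN: "C \<subseteq> N" using p(2) unfolding C_def by (auto simp: image_subset_iff)
  have mem: "p j \<in> C" "p (Suc i) \<in> C" unfolding C_def using ij \<open>j < k\<close> by auto
  have sub: "{Suc i..k - 1} \<subseteq> {..k}" by auto
  have notin: "p k \<notin> C" "p i \<notin> C" "p i \<noteq> p k"
    unfolding C_def using ij \<open>j < k\<close> inj_on_image_mem_iff[OF p(1) _ sub]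
    by (auto dest: inj_onD[OF p(1)])
  have adj: "(p k, p j) \<in> E" "(p j, p k) \<in> E" "(p i, p (Suc i)) \<in> E" "(p (Suc i), p i) \<in> E"
    "(p k, p i) \<in> E" "(p i, p k) \<in> E"
    using ij p(3)[of i] \<open>j < k\<close> E(2) by (auto dest: symD)
  have pN: "p k \<in> N" "p i \<in> N" using p(2) ij \<open>j < k\<close> by auto
  define f where "f n = (if n = 0 then {p k} else if n = 1 then {p i} else C)" for n :: nat
  have "branch_sets N E 3 f"
    unfolding branch_sets_def numeral_3_eq_3 All_less_Suc f_def
    using C CN mem notin adj pN by (auto intro: connected_from.singleton)
  then show ?thesis
    unfolding has_model_def using branch_sets_size[OF _ fin] by (intro exI[of _ f] conjI of_nat_mono)
qed

text \<open>A vertex of degree at most 2 is deleted. If some neighbour \<open>u\<close> of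
  \<open>v\<close> has at most one common neighbour with \<open>v\<close>, then \<open>v\<close> is
  contracted into \<open>u\<close>. Otherwise the neighbourhood of \<open>v\<close> has minimum
  degree at least 2, and its triangle model together with \<open>v\<close> is the required model.
  The loss of 4 counts arcs, that is two edges.\<close>

lemma eliminate_vertex:
  assumes G: "simple_graph V R" and v: "v \<in> V"
  shows "has_model V R 4 (card (R `` {v}) + 1) \<or>
    (\<exists>u R'. simple_graph (V - {v}) R' \<and> card R \<le> card R' + 4 \<and>
      R \<inter> (V - {v}) \<times> (V - {v}) \<subseteq> R' \<and>
      (\<forall>x y. (x, y) \<in> R' \<longrightarrow> (x, y) \<notin> R \<longrightarrow> (u = x \<or> u = y) \<and> (v, x) \<in> R \<and> (v, y) \<in> R))"
proof -
  let ?N = "R `` {v}" and ?E = "R \<inter> (V - {v}) \<times> (V - {v})"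
  have fin: "finite V" "finite R" and R: "R \<subseteq> V \<times> V" "sym R" "irrefl R"
    using G simple_graph_finite_rel[OF G] unfolding simple_graph_def by auto
  have N: "?N \<subseteq> V" "v \<notin> ?N" using R by (auto simp: irrefl_def)
  have finN: "finite ?N" using N(1) fin(1) by (rule finite_subset)
  have GE: "simple_graph (V - {v}) ?E" using G by (rule simple_graph_restrict) auto
  have cR: "card R \<le> card ?E + 2 * card ?N"
  proof -
    have "R \<subseteq> ?E \<union> ({v} \<times> ?N \<union> ?N \<times> {v})" using R(1,2) by (auto dest: symD)
    then have "card R \<le> card (?E \<union> ({v} \<times> ?N \<union> ?N \<times> {v}))"
      using fin finN by (intro card_mono) auto
    also have "\<dots> \<le> card ?E + (card ({v} \<times> ?N) + card (?N \<times> {v}))"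
      by (rule order_trans[OF card_Un_le add_left_mono[OF card_Un_le]])
    finally show ?thesis by (simp add: card_cartesian_product)
  qed
  consider (small) "card ?N \<le> 2" | (contract) u where "u \<in> ?N" "card (R `` {u} \<inter> ?N) \<le> 1"
    | (dense) "card ?N > 2" "\<forall>u\<in>?N. \<not> card (R `` {u} \<inter> ?N) \<le> 1"
    using not_le by blast
  then show ?thesis
  proof cases
    case small
    then have "card R \<le> card ?E + 4" using cR by simp
    then show ?thesis using GE by blast
  next
    case contract
    define M where "M = ?N - {u} - R `` {u}"
    let ?R = "?E \<union> ({u} \<times> M \<union> M \<times> {u})"
    have finM: "finite M" unfolding M_def using finN by simp
    \<comment> \<open>Among the neighbours of \<open>v\<close>, only \<open>u\<close> and at most
      one common neighbour fail to give a new edge at \<open>u\<close>.\<close>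
    have "?N - {u} \<subseteq> M \<union> (R `` {u} \<inter> ?N)" unfolding M_def by blast
    then have "card (?N - {u}) \<le> card (M \<union> (R `` {u} \<inter> ?N))"
      using finM finN by (intro card_mono) auto
    also have "\<dots> \<le> card M + card (R `` {u} \<inter> ?N)" by (rule card_Un_le)
    also have "\<dots> \<le> card M + 1" using contract(2) by simp
    finally have cM: "card ?N \<le> card M + 2" using contract(1) finN by simp
    have "card ?R = card ?E + card ({u} \<times> M \<union> M \<times> {u})"
      using fin finM R(2) unfolding M_def by (intro card_Un_disjoint) (auto dest: symD)
    also have "card ({u} \<times> M \<union> M \<times> {u}) = card ({u} \<times> M) + card (M \<times> {u})"
      using finM unfolding M_def by (intro card_Un_disjoint) auto
    finally have "card ?R = card ?E + 2 * card M" by (simp add: card_cartesian_product)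
    then have "card R \<le> card ?R + 4" using cR cM by linarith
    moreover have "simple_graph (V - {v}) ?R"
      unfolding simple_graph_def
    proof (intro conjI)
      show "finite (V - {v})" using fin by simp
      show "?R \<subseteq> (V - {v}) \<times> (V - {v})" using N contract(1) unfolding M_def by auto
      show "sym ?R" using R(2) by (auto simp: sym_def)
      show "irrefl ?R" using R(3) unfolding M_def by (auto simp: irrefl_def)
    qed
    moreover have "\<forall>x y. (x, y) \<in> ?R \<longrightarrow> (x, y) \<notin> R \<longrightarrow> (u = x \<or> u = y) \<and> (v, x) \<in> R \<and> (v, y) \<in> R"
      using contract(1) unfolding M_def by blast
    ultimately show ?thesis by blast
  next
    case dense
    have GN: "simple_graph ?N (R \<inter> ?N \<times> ?N)" using G N(1) by (rule simple_graph_restrict)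
    have "2 \<le> card ((R \<inter> ?N \<times> ?N) `` {u})" if "u \<in> ?N" for u
    proof -
      have "(R \<inter> ?N \<times> ?N) `` {u} = R `` {u} \<inter> ?N" using that by blast
      then show ?thesis using bspec[OF dense(2) that] by simp
    qed
    moreover have "?N \<noteq> {}" using dense(1) by force
    ultimately have "has_model ?N (R \<inter> ?N \<times> ?N) 3 (card ?N)"
      using min_degree_two_triangle_model[OF GN] by blast
    then have "has_model ?N R 3 (card ?N)" by (rule has_model_mono) auto
    then have "has_model V R (Suc 3) (real (card ?N) + 1)"
    proof (rule has_model_apex[OF _ R(2) N(1) fin(1)])
      fix f assume f: "branch_sets ?N R 3 f"
      have "\<exists>a\<in>f i. \<exists>b\<in>{v}. (a, b) \<in> R" if "i < 3" for i
        using branch_sets_nonempty[OF f that] R(2) by (auto dest: symD)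
      then show "\<exists>x A. connected_from R x A \<and> A \<subseteq> V - ?N \<and> real (card A) \<le> 1 \<and>
          (\<forall>i<3. \<exists>a\<in>f i. \<exists>b\<in>A. (a, b) \<in> R)"
        using v N(2) by (intro exI[of _ v] exI[of _ "{v}"]) (auto intro: connected_from.singleton)
    qed
    then show ?thesis by (simp add: eval_nat_numeral add.commute)
  qed
qed

text \<open>New arcs join two neighbours of the eliminated vertex, and these lie outside
  \<open>S\<close>. So the neighbourhoods of the remaining vertices of \<open>S\<close> never
  change: degrees stay bounded, and every new arc is a path of length two in the original
  \<open>R\<close>. Hence a single lifting, at the factor \<open>10 = 2 * 4 + 2\<close>, undoes all
  eliminations at once.\<close>

lemma eliminate_independent_set:
  fixes k :: real
  assumes G: "simple_graph V R" and S: "S \<subseteq> V" "R \<inter> S \<times> S = {}"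
    and deg: "\<And>v. v \<in> S \<Longrightarrow> card (R `` {v}) \<le> k"
    and nomodel: "\<not> has_model V R 4 (10 * (k + 1))"
  obtains R' where "simple_graph (V - S) R'" "card R \<le> card R' + 4 * card S"
    "\<And>s. has_model (V - S) R' 4 s \<Longrightarrow> has_model V R 4 (10 * s)"
proof -
  have fin: "finite V" "finite S" and "sym R"
    using G S(1) finite_subset unfolding simple_graph_def by auto
  have "\<exists>R' u. simple_graph (V - T) R' \<and> card R \<le> card R' + 4 * card T \<and>
      (\<forall>x y. (x, y) \<in> R' \<longrightarrow> (x, y) \<notin> R \<longrightarrow>
        (\<exists>v\<in>T. (u v = x \<or> u v = y) \<and> (v, x) \<in> R \<and> (v, y) \<in> R)) \<and>
      (\<forall>v\<in>S - T. R' `` {v} = R `` {v})"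
    if "finite T" "T \<subseteq> S" for T
    using that
  proof (induction rule: finite_induct)
    case empty
    show ?case using G by (intro exI[of _ R]) auto
  next
    case (insert v T)
    then obtain R' u where G': "simple_graph (V - T) R'" and card: "card R \<le> card R' + 4 * card T"
      and arc: "\<forall>x y. (x, y) \<in> R' \<longrightarrow> (x, y) \<notin> R \<longrightarrow>
        (\<exists>v\<in>T. (u v = x \<or> u v = y) \<and> (v, x) \<in> R \<and> (v, y) \<in> R)"
      and same: "\<forall>v\<in>S - T. R' `` {v} = R `` {v}"
      by blast
    have v: "v \<in> V - T" "v \<in> S - T" "T \<subseteq> V" "v \<in> S" using insert.prems insert.hyps S(1) by auto
    have Nv: "R' `` {v} = R `` {v}" using same v(2) by blast
    \<comment> \<open>A bounded model around \<open>v\<close> in the current graph would lift to the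
      model excluded by \<open>nomodel\<close>.\<close>
    have "\<not> has_model (V - T) R' 4 (card (R' `` {v}) + 1)"
    proof
      assume "has_model (V - T) R' 4 (card (R' `` {v}) + 1)"
      from lift_has_model[OF this \<open>sym R\<close> v(3) arc[rule_format]]
      have "has_model V R 4 ((2 * real 4 + 2) * (card (R' `` {v}) + 1))" by simp
      then have "has_model V R 4 (10 * (k + 1))"
        by (rule has_model_mono) (use deg[OF v(4)] Nv in auto)
      then show False using nomodel by simp
    qed
    then obtain u0 R'' where G'': "simple_graph (V - T - {v}) R''"
      and card'': "card R' \<le> card R'' + 4"
      and keep: "R' \<inter> (V - T - {v}) \<times> (V - T - {v}) \<subseteq> R''"
      and arc'': "\<forall>x y. (x, y) \<in> R'' \<longrightarrow> (x, y) \<notin> R' \<longrightarrow>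
        (u0 = x \<or> u0 = y) \<and> (v, x) \<in> R' \<and> (v, y) \<in> R'"
      using eliminate_vertex[OF G' v(1)] by blast
    have "\<exists>w\<in>insert v T. ((u(v := u0)) w = x \<or> (u(v := u0)) w = y) \<and> (w, x) \<in> R \<and> (w, y) \<in> R"
      if xy: "(x, y) \<in> R''" "(x, y) \<notin> R" for x y
    proof (cases "(x, y) \<in> R'")
      case True
      then obtain w where "w \<in> T" "u w = x \<or> u w = y" "(w, x) \<in> R" "(w, y) \<in> R"
        using arc xy(2) by blast
      then show ?thesis using insert.hyps(2) by (intro bexI[of _ w]) auto
    next
      case False
      then show ?thesis using arc'' xy(1) Nv by (intro bexI[of _ v]) auto
    qed
    then have "\<forall>x y. (x, y) \<in> R'' \<longrightarrow> (x, y) \<notin> R \<longrightarrow> (\<exists>w\<in>insert v T.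
      ((u(v := u0)) w = x \<or> (u(v := u0)) w = y) \<and> (w, x) \<in> R \<and> (w, y) \<in> R)" by blast
    \<comment> \<open>An arc at \<open>z\<close> that is new in this round would make
      \<open>z\<close> a neighbour of \<open>v\<close>, against independence.\<close>
    moreover have "R'' `` {z} = R `` {z}" if z: "z \<in> S - insert v T" for z
    proof (intro equalityI subsetI)
      fix y assume y: "y \<in> R'' `` {z}"
      have "(v, z) \<notin> R" using S(2) v(4) z by blast
      then have "(z, y) \<in> R'" using arc'' y Nv by blast
      then show "y \<in> R `` {z}" using same z by blast
    next
      fix y assume y: "y \<in> R `` {z}"
      then have zy: "(z, y) \<in> R'" using same z by blast
      moreover have "y \<noteq> v" using S(2) v(4) z y by blast
      moreover have "z \<in> V - T" "y \<in> V - T" using zy G' unfolding simple_graph_def by auto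
      ultimately show "y \<in> R'' `` {z}" using keep z by blast
    qed
    moreover have "simple_graph (V - insert v T) R''" using G'' by (metis Diff_insert)
    moreover have "card R \<le> card R'' + 4 * card (insert v T)"
      using card card'' insert.hyps by simp
    ultimately show ?case by (intro exI[of _ R''] exI[of _ "u(v := u0)"] conjI ballI)
  qed
  from this[OF fin(2) order_refl] obtain R' u
    where R': "simple_graph (V - S) R'" "card R \<le> card R' + 4 * card S"
    and arc: "\<forall>x y. (x, y) \<in> R' \<longrightarrow> (x, y) \<notin> R \<longrightarrow>
      (\<exists>v\<in>S. (u v = x \<or> u v = y) \<and> (v, x) \<in> R \<and> (v, y) \<in> R)"
    by blast
  have "has_model V R 4 (10 * s)" if "has_model (V - S) R' 4 s" for s
    using lift_has_model[OF that \<open>sym R\<close> S(1) arc[rule_format]] by simp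
  with R' show ?thesis using that by blast
qed

section \<open>Independent sets and iterated elimination\<close>

text \<open>By averaging, at least half of the vertices have degree at most \<open>2 * D\<close>. A
  largest independent set among them dominates all of them, and each of its vertices dominates at
  most \<open>2 * D + 1\<close>.\<close>

lemma large_independent_set:
  fixes D :: real
  assumes G: "simple_graph V R" and "card R \<le> D * card V" and "D > 0"
  obtains S where "S \<subseteq> V" "R \<inter> S \<times> S = {}" "\<And>v. v \<in> S \<Longrightarrow> card (R `` {v}) \<le> 2 * D"
    "card V \<le> 2 * (2 * D + 1) * card S"
proof -
  have fin: "finite V" "finite R" and R: "R \<subseteq> V \<times> V" "sym R" "irrefl R"
    using G simple_graph_finite_rel[OF G] unfolding simple_graph_def by auto
  define L where "L = {v \<in> V. card (R `` {v}) \<le> 2 * D}"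
  have L: "L \<subseteq> V" "finite L" using fin unfolding L_def by auto
  have finN: "finite (R `` {v})" for v using fin by simp
  have "R = Sigma V (\<lambda>v. R `` {v})" using R(1) by auto
  then have "card R = (\<Sum>v\<in>V. card (R `` {v}))" using fin finN by (metis card_SigmaI)
  then have "real (card R) = (\<Sum>v\<in>V. real (card (R `` {v})))" by simp
  moreover have "(\<Sum>v\<in>V - L. real (card (R `` {v}))) \<le> (\<Sum>v\<in>V. real (card (R `` {v})))"
    using fin by (intro sum_mono2) auto
  moreover have "(\<Sum>v\<in>V - L. 2 * D) \<le> (\<Sum>v\<in>V - L. real (card (R `` {v})))"
    by (intro sum_mono) (auto simp: L_def)
  ultimately have "D * (2 * card (V - L)) \<le> D * card V" using assms(2) by (simp add: mult_ac)
  then have "2 * real (card (V - L)) \<le> card V" using \<open>D > 0\<close> by simp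
  moreover have "real (card (V - L)) = real (card V) - card L"
    using L fin by (simp add: card_Diff_subset card_mono of_nat_diff)
  ultimately have half: "real (card V) \<le> 2 * card L" by simp
  let ?P = "\<lambda>S. S \<subseteq> L \<and> R \<inter> S \<times> S = {}"
  have "\<exists>S. ?P S \<and> (\<forall>T. ?P T \<longrightarrow> card T \<le> card S)"
    by (rule ex_has_greatest_nat[of ?P "{}" card "Suc (card L)"])
      (use card_mono[OF L(2)] in \<open>auto simp: less_Suc_eq_le\<close>)
  then obtain S where S: "?P S" and max: "\<forall>T. ?P T \<longrightarrow> card T \<le> card S" by blast
  have finS: "finite S" using S L(2) by (auto intro: finite_subset)
  have "L \<subseteq> (\<Union>v\<in>S. insert v (R `` {v}))"
  proof
    fix x assume x: "x \<in> L"
    show "x \<in> (\<Union>v\<in>S. insert v (R `` {v}))"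
    proof (rule ccontr)
      assume nx: "x \<notin> (\<Union>v\<in>S. insert v (R `` {v}))"
      then have "R \<inter> insert x S \<times> insert x S = {}"
        using S R(2,3) by (auto simp: irrefl_def dest: symD)
      then have "card (insert x S) \<le> card S" using S x by (intro max[rule_format]) auto
      then show False using nx finS by auto
    qed
  qed
  then have "card L \<le> card (\<Union>v\<in>S. insert v (R `` {v}))" using finS finN by (intro card_mono) auto
  also have "\<dots> \<le> (\<Sum>v\<in>S. card (insert v (R `` {v})))" using finS by (rule card_UN_le)
  finally have "real (card L) \<le> (\<Sum>v\<in>S. real (card (insert v (R `` {v}))))"
    by (metis of_nat_le_iff of_nat_sum)
  also have "\<dots> \<le> (\<Sum>v\<in>S. 2 * D + 1)"
  proof (rule sum_mono)
    fix v assume "v \<in> S"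
    then have "real (card (R `` {v})) \<le> 2 * D" using S unfolding L_def by blast
    moreover have "card (insert v (R `` {v})) \<le> Suc (card (R `` {v}))"
      using finN by (simp add: card_insert_if)
    ultimately show "real (card (insert v (R `` {v}))) \<le> 2 * D + 1" by linarith
  qed
  finally have "real (card L) \<le> (2 * D + 1) * card S" by (simp add: algebra_simps)
  then have "real (card V) \<le> 2 * (2 * D + 1) * card S" using half by linarith
  moreover have "card (R `` {v}) \<le> 2 * D" if "v \<in> S" for v using that S unfolding L_def by blast
  ultimately show ?thesis using S L(1) by (intro that[of S]) auto
qed

text \<open>A round loses at most 4 arcs per eliminated vertex, so
  \<open>card R - 4 * card V\<close> does not drop while \<open>card V\<close> shrinks by the factor
  \<open>q\<close>. Thus the excess of the average degree over 4 grows from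
  \<open>D * q ^ Suc k\<close> to at least \<open>D * q ^ k\<close>, and at \<open>k = 0\<close> the
  graph is dense enough for \<open>dense_has_logarithmic_model\<close>. The number of rounds depends
  only on \<open>\<epsilon>\<close>.\<close>

theorem logarithmic_K4_model:
  fixes \<epsilon> :: real
  assumes "\<epsilon> > 0"
  shows "\<exists>K. \<forall>(V :: 'a set) R. simple_graph V R \<and> V \<noteq> {} \<and> (4 + \<epsilon>) * card V \<le> card R \<longrightarrow>
    has_model V R 4 (K * (1 + log 2 (card V)))"
proof -
  obtain d C :: real where d: "d \<ge> 0" and C: "C \<ge> 0"
    and dense: "\<forall>(V :: 'a set) R. simple_graph V R \<and> d * card V < card R \<longrightarrow>
      has_model V R 4 (C * (1 + log 2 (card V)))"
    using dense_has_logarithmic_model[of 4, where ?'a = 'a] by blast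
  define D where "D = d + 1"
  \<comment> \<open>The proportion of vertices that \<open>large_independent_set\<close> guarantees;
    \<open>q\<close> is the proportion left after one round.\<close>
  define c where "c = 1 / (2 * (2 * D + 1))"
  define q where "q = 1 - c"
  have D: "D > 0" "d < D" unfolding D_def using d by auto
  have c: "0 < c" "c < 1" unfolding c_def using D by (auto simp: field_simps)
  have q: "0 < q" "q < 1" unfolding q_def using c by auto
  have step: "\<exists>K\<ge>0. \<forall>(V :: 'a set) R. simple_graph V R \<and> V \<noteq> {} \<and> (4 + D * q ^ k) * card V \<le> card R \<longrightarrow>
    has_model V R 4 (K * (1 + log 2 (card V)))" for k
  proof (induction k)
    case 0
    have "has_model V R 4 (C * (1 + log 2 (card V)))"
      if G: "simple_graph V R" "V \<noteq> {}" "(4 + D * q ^ 0) * card V \<le> card R" for V :: "'a set" and R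
    proof -
      have "card V > 0" using G unfolding simple_graph_def by auto
      then have "d * card V < (4 + D * q ^ 0) * card V" using D by (intro mult_strict_right_mono) auto
      then have "d * card V < card R" using G(3) by linarith
      then show ?thesis using dense G(1) by blast
    qed
    then show ?case using C by blast
  next
    case (Suc k)
    then obtain K :: real where K: "K \<ge> 0"
      and IH: "\<forall>(V :: 'a set) R. simple_graph V R \<and> V \<noteq> {} \<and> (4 + D * q ^ k) * card V \<le> card R \<longrightarrow>
        has_model V R 4 (K * (1 + log 2 (card V)))"
      by blast
    \<comment> \<open>One summand for each outcome: the graph is already dense, a model of bounded
      size exists, or a model is lifted from the smaller graph.\<close>
    define K' where "K' = C + 10 * (2 * D + 1) + 10 * K"
    have "has_model V R 4 (K' * (1 + log 2 (card V)))"
      if G: "simple_graph V R" "V \<noteq> {}" "(4 + D * q ^ Suc k) * card V \<le> card R"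
      for V :: "'a set" and R
    proof -
      have finV: "finite V" using G(1) unfolding simple_graph_def by blast
      then have n: "card V \<ge> 1" using G(2) by (simp add: Suc_le_eq card_gt_0_iff)
      define l where "l = 1 + log 2 (card V)"
      have l: "l \<ge> 1" unfolding l_def using n by simp
      have weaken: "has_model V R 4 (K' * l)" if "has_model V R 4 (s * l)" "s \<le> K'" for s
        using has_model_mono[OF that(1) order_refl order_refl] that(2) l by (simp add: mult_right_mono)
      have "has_model V R 4 (K' * l)"
      proof (cases "D * card V < card R")
        case True
        have "d * card V \<le> D * card V" using D by (intro mult_right_mono) auto
        then have "has_model V R 4 (C * l)" using dense G(1) True unfolding l_def by force
        then show ?thesis by (rule weaken) (use D K in \<open>simp add: K'_def\<close>)
      next
        case False
        then have "card R \<le> D * card V" by simp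
        then obtain S where S: "S \<subseteq> V" "R \<inter> S \<times> S = {}" "\<And>v. v \<in> S \<Longrightarrow> card (R `` {v}) \<le> 2 * D"
          "card V \<le> 2 * (2 * D + 1) * card S"
          using large_independent_set[OF G(1) _ D(1)] by blast
        show ?thesis
        proof (cases "has_model V R 4 (10 * (2 * D + 1))")
          case True
          moreover have "10 * (2 * D + 1) * 1 \<le> 10 * (2 * D + 1) * l"
            using D l by (intro mult_left_mono) auto
          ultimately have "has_model V R 4 (10 * (2 * D + 1) * l)"
            using has_model_mono[OF _ order_refl order_refl] by simp
          then show ?thesis by (rule weaken) (use C K in \<open>simp add: K'_def\<close>)
        next
          case False
          obtain R' where R': "simple_graph (V - S) R'" "card R \<le> card R' + 4 * card S"
            and lift: "\<And>s. has_model (V - S) R' 4 s \<Longrightarrow> has_model V R 4 (10 * s)"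
            using eliminate_independent_set[OF G(1) S(1,2,3) False] by blast
          have nS: "real (card (V - S)) = real (card V) - card S"
            using S(1) finV by (simp add: card_Diff_subset card_mono finite_subset of_nat_diff)
          have "c * card V \<le> card S"
            using S(4) D unfolding c_def by (simp add: field_simps)
          then have small: "card (V - S) \<le> q * card V" unfolding nS q_def by (simp add: algebra_simps)
          have "4 * card (V - S) + D * q ^ k * (q * card V) \<le> card R'"
            using R'(2) G(3) nS by (simp add: algebra_simps)
          moreover have "D * q ^ k * card (V - S) \<le> D * q ^ k * (q * card V)"
            using small D q by (intro mult_left_mono) auto
          ultimately have dense': "(4 + D * q ^ k) * card (V - S) \<le> card R'"
            by (simp add: algebra_simps)
          \<comment> \<open>Eliminating every vertex would leave no arcs, although the positive
            excess is preserved.\<close>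
          have "V - S \<noteq> {}"
          proof
            assume e: "V - S = {}"
            then have "R' = {}" using R'(1) unfolding simple_graph_def by auto
            then have "D * q ^ k * (q * card V) \<le> 0"
              using \<open>4 * card (V - S) + D * q ^ k * (q * card V) \<le> card R'\<close> e by simp
            moreover have "D * q ^ k * (q * card V) > 0" using D q n by simp
            ultimately show False by linarith
          qed
          then have "has_model (V - S) R' 4 (K * (1 + log 2 (card (V - S))))"
            using IH R'(1) dense' by blast
          then have "has_model V R 4 (10 * (K * (1 + log 2 (card (V - S)))))" by (rule lift)
          moreover have "1 + log 2 (card (V - S)) \<le> l"
          proof -
            have "card (V - S) > 0" using \<open>V - S \<noteq> {}\<close> finV by (simp add: card_gt_0_iff)
            moreover have "card (V - S) \<le> card V" using finV by (intro card_mono) auto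
            ultimately show ?thesis unfolding l_def by simp
          qed
          then have "10 * (K * (1 + log 2 (card (V - S)))) \<le> 10 * K * l" using K by (simp add: mult_left_mono)
          ultimately have "has_model V R 4 (10 * K * l)"
            using has_model_mono[OF _ order_refl order_refl] by blast
          then show ?thesis by (rule weaken) (use C D in \<open>simp add: K'_def\<close>)
        qed
      qed
      then show ?thesis unfolding l_def .
    qed
    moreover have "K' \<ge> 0" unfolding K'_def using C D K by simp
    ultimately show ?case by blast
  qed
  obtain k where k: "q ^ k < \<epsilon> / D"
    using real_arch_pow_inv[of "\<epsilon> / D" q] assms D q by auto
  then have "D * q ^ k \<le> \<epsilon>" using D by (simp add: field_simps)
  then have "(4 + D * q ^ k) * card V \<le> (4 + \<epsilon>) * card V" for V :: "'a set"
    by (intro mult_right_mono) auto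
  then show ?thesis using step[of k] by (meson order_trans)
qed

section \<open>Transfer to symmetric digraphs\<close>

text \<open>Forgetting directions has fibres of size exactly two, by symmetry and the absence of
  loops.\<close>

lemma card_arcs_ends:
  assumes "Digraph.graph G"
  shows "card (arcs_ends G) = 2 * card (edge_set G)"
proof -
  interpret Digraph.graph G by fact
  let ?A = "arcs_ends G" and ?E = "edge_set G" and ?h = "\<lambda>(u, v). {u, v}"
  have fin: "finite ?A" unfolding arcs_ends_def by simp
  have edge: "?E = ?h ` ?A"
    unfolding edge_set_def arcs_ends_def arc_to_ends_def by (auto simp: image_image)
  have fibre: "card {a \<in> ?A. ?h a = e} = 2" if e: "e \<in> ?E" for e
  proof -
    obtain u v where uv: "(u, v) \<in> ?A" "e = {u, v}" using e unfolding edge by auto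
    have vu: "(v, u) \<in> ?A" using uv(1) sym_arcs unfolding symmetric_def by (meson symD)
    have "{a \<in> ?A. ?h a = e} = {(u, v), (v, u)}"
    proof (intro equalityI subsetI)
      fix a assume "a \<in> {a \<in> ?A. ?h a = e}"
      then show "a \<in> {(u, v), (v, u)}" using uv(2) by (cases a) (simp add: doubleton_eq_iff)
    next
      fix a assume "a \<in> {(u, v), (v, u)}"
      then show "a \<in> {a \<in> ?A. ?h a = e}" using uv vu by (elim insertE) (simp_all add: insert_commute)
    qed
    moreover have "u \<noteq> v" using uv(1) no_loops unfolding arcs_ends_def arc_to_ends_def by auto
    ultimately show ?thesis by simp
  qed
  have "card ?A = (\<Sum>e\<in>?E. card {a \<in> ?A. ?h a = e})"
    unfolding edge using sum.image_gen[OF fin, of "\<lambda>_. 1::nat" ?h] by simp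
  then show ?thesis using fibre by simp
qed

text \<open>Symmetry turns reachability from the root into reachability between any two vertices,
  and makes the symmetric closure in the definition of connectivity harmless.\<close>

lemma connected_induce_subgraph:
  assumes G: "Digraph.graph G" and con: "connected_from (arcs_ends G) x B" and B: "B \<subseteq> verts G"
  shows "Digraph_Component.connected (G \<restriction> B)"
proof -
  interpret Digraph.graph G by fact
  interpret I: wf_digraph "G \<restriction> B" by (rule wellformed_induce_subgraph)
  have sym: "symmetric (G \<restriction> B)"
    using sym_arcs induced_induce[OF B] by (rule induced_graph_imp_symmetric)
  have "\<forall>y\<in>C. x \<rightarrow>\<^sup>*\<^bsub>G \<restriction> B\<^esub> y" if "connected_from (arcs_ends G) x C" "C \<subseteq> B" for C
    using that
  proof (induction rule: connected_from.induct)
    case singleton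
    then show ?case by simp
  next
    case (extend C y z)
    then have "y \<rightarrow>\<^bsub>G \<restriction> B\<^esub> z" unfolding arcs_ends_conv by auto
    then show ?case using extend I.reachable_adj_trans by blast
  qed
  then have reach: "x \<rightarrow>\<^sup>*\<^bsub>G \<restriction> B\<^esub> y" if "y \<in> B" for y using con that by blast
  have "u \<rightarrow>\<^sup>*\<^bsub>G \<restriction> B\<^esub> v" if "u \<in> B" "v \<in> B" for u v
    using I.reachable_trans[OF symmetric_reachable[OF sym reach[OF that(1)]] reach[OF that(2)]] .
  moreover have "B \<noteq> {}" using connected_from_root[OF con] by blast
  ultimately have "strongly_connected (G \<restriction> B)" unfolding strongly_connected_def by simp
  then show ?thesis
    unfolding Digraph_Component.connected_def strongly_connected_def
    using I.reachable_mk_symmetric_eq[OF sym] by simp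
qed

lemma clique_model_induce_subgraph:
  assumes G: "Digraph.graph G" and f: "branch_sets (verts G) (arcs_ends G) t f"
  shows "clique_model t G (\<lambda>i. G \<restriction> f i)"
proof -
  interpret Digraph.graph G by fact
  show ?thesis
    unfolding clique_model_def
  proof (intro conjI allI impI)
    fix i assume "i < t"
    then obtain x where x: "connected_from (arcs_ends G) x (f i)" "f i \<subseteq> verts G"
      using f unfolding branch_sets_def by blast
    show "subgraph (G \<restriction> f i) G" using x(2) by (rule subgraph_induce_subgraphI)
    show "symmetric (G \<restriction> f i)"
      using sym_arcs induced_induce[OF x(2)] by (rule induced_graph_imp_symmetric)
    show "Digraph_Component.connected (G \<restriction> f i)" using G x by (rule connected_induce_subgraph)
  qed (use f in \<open>auto simp: branch_sets_def\<close>)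
qed

theorem theorem3p3:
  shows "\<exists>h :: real \<Rightarrow> real. \<forall>\<epsilon>>0. \<forall>G :: ('a, 'b) pre_digraph.
    Digraph.graph G \<and> avg_degree G \<ge> 4 + \<epsilon> \<longrightarrow>
    (\<exists>B. clique_model 4 G B \<and>
         real (model_size 4 B) \<le> h \<epsilon> * log 2 (real (card (verts G))))"
proof -
  have "\<exists>K. \<epsilon> > 0 \<longrightarrow> (\<forall>(V :: 'a set) R. simple_graph V R \<and> V \<noteq> {} \<and> (4 + \<epsilon>) * card V \<le> card R \<longrightarrow>
    has_model V R 4 (K * (1 + log 2 (card V))))" for \<epsilon> :: real
    using logarithmic_K4_model[of \<epsilon>, where ?'a = 'a] by blast
  then obtain K :: "real \<Rightarrow> real" where K: "\<forall>\<epsilon>>0::real. \<forall>(V :: 'a set) R.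
      simple_graph V R \<and> V \<noteq> {} \<and> (4 + \<epsilon>) * card V \<le> card R \<longrightarrow>
      has_model V R 4 (K \<epsilon> * (1 + log 2 (card V)))"
    by metis
  show ?thesis
  \<comment> \<open>The factor 2 absorbs the summand 1, as the logarithm is at least 1 once there
    are two vertices; the sign of \<open>K \<epsilon>\<close> is unknown, hence the absolute
    value.\<close>
  proof (intro exI[of _ "\<lambda>\<epsilon>. 2 * \<bar>K \<epsilon>\<bar>"] allI impI)
    fix \<epsilon> :: real and G :: "('a, 'b) pre_digraph"
    assume "\<epsilon> > 0" and "Digraph.graph G \<and> avg_degree G \<ge> 4 + \<epsilon>"
    then have G: "Digraph.graph G" and avg: "avg_degree G \<ge> 4 + \<epsilon>" by auto
    interpret Digraph.graph G by fact
    let ?V = "verts G" and ?R = "arcs_ends G"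
    let ?n = "real (card ?V)"
    \<comment> \<open>The null graph has average degree 0 by the convention on division.\<close>
    have "card ?V \<noteq> 0" using avg \<open>\<epsilon> > 0\<close> unfolding avg_degree_def by (intro notI) simp
    then have ne: "?V \<noteq> {}" and pos: "?n > 0" by auto
    have "(4 + \<epsilon>) * ?n \<le> avg_degree G * ?n" using avg pos by (intro mult_right_mono) auto
    also have "\<dots> = card ?R" 
      using ne card_arcs_ends[OF G] unfolding avg_degree_def by simp
    finally have dense: "(4 + \<epsilon>) * ?n \<le> card ?R" .
    have simple: "simple_graph ?V ?R"
      unfolding simple_graph_def
    proof (intro conjI)
      show "?R \<subseteq> ?V \<times> ?V" using adj_in_verts by auto
      show "sym ?R" using sym_arcs unfolding symmetric_def .
      show "irrefl ?R" using adj_not_same unfolding irrefl_def by blast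
    qed simp
    have "card ?V \<ge> 2"
    proof (rule ccontr)
      assume "\<not> 2 \<le> card ?V"
      then have "card ?V = 1" using \<open>card ?V \<noteq> 0\<close> by linarith
      then obtain v where "?V = {v}" by (rule card_1_singletonE)
      then have "?R = {}" using simple unfolding simple_graph_def irrefl_def by auto
      then show False using dense pos \<open>\<epsilon> > 0\<close> by (simp add: mult_le_0_iff)
    qed
    then have log: "log 2 ?n \<ge> 1" by (simp add: le_log_iff)
    have "has_model ?V ?R 4 (K \<epsilon> * (1 + log 2 ?n))" using K \<open>\<epsilon> > 0\<close> simple ne dense by blast
    then obtain f where f: "branch_sets ?V ?R 4 f"
      "real (\<Sum>i<4. card (f i)) \<le> K \<epsilon> * (1 + log 2 ?n)"
      unfolding has_model_def by blast
    have "K \<epsilon> * (1 + log 2 ?n) \<le> \<bar>K \<epsilon>\<bar> * (2 * log 2 ?n)"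
      using log by (intro mult_mono) auto
    then have "real (model_size 4 (\<lambda>i. G \<restriction> f i)) \<le> 2 * \<bar>K \<epsilon>\<bar> * log 2 ?n"
      using f(2) unfolding model_size_def by simp
    then show "\<exists>B. clique_model 4 G B \<and> real (model_size 4 B) \<le> 2 * \<bar>K \<epsilon>\<bar> * log 2 ?n"
      using clique_model_induce_subgraph[OF G f(1)] by blast
  qed
qed

end
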